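(* Let $n \ge 2$ and $m \ge 1$ be integers, and let $X = \{x_0, x_1, \ldots, x_m\}$ be a set of $m+1$ distinct points of $\{0,1\}^n$. Then $\wp_{(X,d_p)} \ge p$ for all real $p \ge 1$. Furthermore, the following conditions are equivalent. \begin{enumerate} \item $X$ is affinely independent (as a subset of $\mathbb{R}^n$). \item $(X, d_1)$ has strict $1$-negative type. \item $\wp_{(X,d_p)} > p$ for some real $p \ge 1$. \item $\wp_{(X,d_p)} > p$ for all real $p \ge 1$. \end{enumerate}
   Context: For real $p \ge 1$, $d_p$ denotes the $\ell_p$-metric $d_p(x,y) = \left(\sum_{k=1}^n |x_k-y_k|^p\right)^{1/p}$ on $\mathbb{R}^n$, restricted to $X$. Let $(Y,\rho)$ be a metric space and let $q \ge 0$. $(Y,\rho)$ has $q$-negative type iff for each finite subset $\{y_0,\ldots,y_k\}$ of $Y$ (distinct points) and all real scalars $\xi_0,\ldots,\xi_k$ with $\xi_0+\cdots+\xi_k = 0$ one has \[ \sum_{i,j=0}^k \rho(y_i,y_j)^q\, \xi_i \xi_j \le 0 . \] $(Y,\rho)$ has strict $q$-negative type iff it has $q$-negative type and each of these inequalities is strict whenever $(\xi_0,\ldots,\xi_k) \neq \mathbf{0}$. The supremal negative type $\wp_{(Y,\rho)} \in [0,\infty]$ is the supremum of all $q \ge 0$ such that $(Y,\rho)$ has $q$-negative type. *)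

theory Defs
  imports "HOL-Analysis.Analysis"
begin

definition lp_dist :: "real \<Rightarrow> real ^ 'n \<Rightarrow> real ^ 'n \<Rightarrow> real" where
  "lp_dist p x y = (\<Sum>k\<in>UNIV. \<bar>x $ k - y $ k\<bar> powr p) powr (1 / p)"

text \<open>
  A metric space is given by its carrier and its distance function. A finite set of distinct
  points with scalars attached to them is a finite subset \<open>F\<close> of the carrier with a weight
  function \<open>\<xi>\<close>, of which only the values on \<open>F\<close> matter. As \<open>0 powr 0 = 0\<close>, the diagonal terms
  vanish also for exponent \<open>q = 0\<close>; under either convention for \<open>0\<^sup>0\<close> every space has
  \<open>0\<close>-negative type.
\<close>

definition negative_type :: "'a set \<Rightarrow> ('a \<Rightarrow> 'a \<Rightarrow> real) \<Rightarrow> real \<Rightarrow> bool" where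
  "negative_type Y \<rho> q \<longleftrightarrow>
    (\<forall>F \<xi>. finite F \<and> F \<subseteq> Y \<and> (\<Sum>y\<in>F. \<xi> y) = 0 \<longrightarrow>
      (\<Sum>y\<in>F. \<Sum>z\<in>F. \<rho> y z powr q * \<xi> y * \<xi> z) \<le> 0)"

definition strict_negative_type :: "'a set \<Rightarrow> ('a \<Rightarrow> 'a \<Rightarrow> real) \<Rightarrow> real \<Rightarrow> bool" where
  "strict_negative_type Y \<rho> q \<longleftrightarrow>
    negative_type Y \<rho> q \<and>
    (\<forall>F \<xi>. finite F \<and> F \<subseteq> Y \<and> (\<Sum>y\<in>F. \<xi> y) = 0 \<and> (\<exists>y\<in>F. \<xi> y \<noteq> 0) \<longrightarrow>
      (\<Sum>y\<in>F. \<Sum>z\<in>F. \<rho> y z powr q * \<xi> y * \<xi> z) < 0)"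

definition supremal_negative_type :: "'a set \<Rightarrow> ('a \<Rightarrow> 'a \<Rightarrow> real) \<Rightarrow> ennreal" where
  "supremal_negative_type Y \<rho> = (SUP q\<in>{q. 0 \<le> q \<and> negative_type Y \<rho> q}. ennreal q)"

end

theory Submission
  imports Defs
begin

text \<open>
  On the cube, \<open>d\<^sub>p\<close> to the power \<open>p\<close> is the Hamming distance \<open>h\<close>, so \<open>d\<^sub>p\<close> has \<open>q\<close>-negative type
  iff \<open>h\<close> has \<open>(q/p)\<close>-negative type. Since \<open>|s - t| = s + t - 2st\<close> for \<open>s, t \<in> {0, 1}\<close>, the
  quadratic form of \<open>h\<close> on weights \<open>\<xi>\<close> of sum zero is \<open>- 2 \<parallel>\<Sum> \<xi>\<^sub>x x\<parallel>\<^sup>2\<close>; hence \<open>h\<close> has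
  \<open>1\<close>-negative type, and it is strict iff the points are affinely independent.

  On a finite set, strictness at exponent \<open>1\<close> is equivalent to negative type for some \<open>q > 1\<close>. One
  direction is compactness of the \<open>\<ell>\<^sup>1\<close> unit sphere. For the other, put \<open>D = h\<^sup>q\<close> and \<open>a = 1/q\<close>, and
  integrate the positive semidefinite kernels \<open>exp (- s D)\<close> (Schoenberg) in
  \<open>C t\<^sup>a = \<integral> (1 - exp (- s t)) s\<^sup>-\<^sup>1\<^sup>-\<^sup>a ds\<close>. The result is strict because \<open>exp (- s D)\<close> tends to
  the identity matrix as \<open>s \<rightarrow> \<infinity>\<close>.
\<close>

subsection \<open>Positive semidefinite and conditionally negative kernels\<close>

text \<open>Symmetry is kept apart in \<open>sym_on_set\<close>, since \<open>schur_product\<close>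
  asks it of one factor only.\<close>

definition psd_on :: "'a set \<Rightarrow> ('a \<Rightarrow> 'a \<Rightarrow> real) \<Rightarrow> bool" where
  "psd_on A K \<longleftrightarrow> (\<forall>\<xi>. 0 \<le> (\<Sum>x\<in>A. \<Sum>y\<in>A. K x y * \<xi> x * \<xi> y))"

definition sym_on_set :: "'a set \<Rightarrow> ('a \<Rightarrow> 'a \<Rightarrow> real) \<Rightarrow> bool" where
  "sym_on_set A K \<longleftrightarrow> (\<forall>x\<in>A. \<forall>y\<in>A. K x y = K y x)"

lemma psd_onD: "psd_on A K \<Longrightarrow> 0 \<le> (\<Sum>x\<in>A. \<Sum>y\<in>A. K x y * \<xi> x * \<xi> y)"
  by (simp add: psd_on_def)

lemma sym_on_setD: "sym_on_set A K \<Longrightarrow> x \<in> A \<Longrightarrow> y \<in> A \<Longrightarrow> K x y = K y x"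
  by (simp add: sym_on_set_def)

lemma psd_on_cong:
  assumes "\<And>x y. x \<in> A \<Longrightarrow> y \<in> A \<Longrightarrow> K x y = L x y"
  shows "psd_on A K \<longleftrightarrow> psd_on A L"
  using assms by (simp add: psd_on_def)

text \<open>Isolates the weight at \<open>a\<close>, so that this single weight can be chosen
  freely: to minimise the form in the Schur complement, or to make the weights sum to zero in
  Schoenberg's theorem.\<close>

lemma quadratic_form_insert:
  assumes "finite A" "a \<notin> A" "sym_on_set (insert a A) K"
  shows "(\<Sum>x\<in>insert a A. \<Sum>y\<in>insert a A. K x y * \<xi> x * \<xi> y) =
    K a a * (\<xi> a)\<^sup>2 + 2 * \<xi> a * (\<Sum>y\<in>A. K a y * \<xi> y) + (\<Sum>x\<in>A. \<Sum>y\<in>A. K x y * \<xi> x * \<xi> y)"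
proof -
  have 1: "(\<Sum>x\<in>A. K x a * \<xi> x * \<xi> a) = \<xi> a * (\<Sum>y\<in>A. K a y * \<xi> y)"
    unfolding sum_distrib_left
  proof (rule sum.cong[OF refl])
    fix x assume "x \<in> A"
    then have "K x a = K a x" by (intro sym_on_setD[OF assms(3)]) auto
    then show "K x a * \<xi> x * \<xi> a = \<xi> a * (K a x * \<xi> x)" by simp
  qed
  have 2: "(\<Sum>x\<in>A. K a x * \<xi> a * \<xi> x) = \<xi> a * (\<Sum>y\<in>A. K a y * \<xi> y)"
    by (simp add: sum_distrib_left mult_ac)
  have "(\<Sum>x\<in>insert a A. \<Sum>y\<in>insert a A. K x y * \<xi> x * \<xi> y) =
      (K a a * \<xi> a * \<xi> a + (\<Sum>x\<in>A. K a x * \<xi> a * \<xi> x))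
      + ((\<Sum>x\<in>A. K x a * \<xi> x * \<xi> a) + (\<Sum>x\<in>A. \<Sum>y\<in>A. K x y * \<xi> x * \<xi> y))"
    using assms(1,2) by (simp add: sum.distrib)
  then show ?thesis
    unfolding 1 2 by (simp add: power2_eq_square)
qed

lemma sum_quadratic_extend:
  fixes D :: "'a \<Rightarrow> 'a \<Rightarrow> real"
  assumes "finite B" "A \<subseteq> B"
  shows "(\<Sum>x\<in>B. \<Sum>y\<in>B. D x y * (if x \<in> A then \<xi> x else 0) * (if y \<in> A then \<xi> y else 0))
    = (\<Sum>x\<in>A. \<Sum>y\<in>A. D x y * \<xi> x * \<xi> y)"
proof -
  let ?\<eta> = "\<lambda>x. if x \<in> A then \<xi> x else 0"
  have "(\<Sum>x\<in>B. \<Sum>y\<in>B. D x y * ?\<eta> x * ?\<eta> y) = (\<Sum>x\<in>A. \<Sum>y\<in>B. D x y * ?\<eta> x * ?\<eta> y)"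
    using assms by (intro sum.mono_neutral_right) auto
  also have "\<dots> = (\<Sum>x\<in>A. \<Sum>y\<in>A. D x y * \<xi> x * \<xi> y)"
    using assms by (intro sum.cong[OF refl]) (simp add: sum.mono_neutral_cong_right)
  finally show ?thesis .
qed

lemma psd_on_subset:
  assumes "psd_on B K" "finite B" "A \<subseteq> B"
  shows "psd_on A K"
  unfolding psd_on_def
proof
  show "0 \<le> (\<Sum>x\<in>A. \<Sum>y\<in>A. K x y * \<xi> x * \<xi> y)" for \<xi>
    using psd_onD[OF assms(1), of "\<lambda>x. if x \<in> A then \<xi> x else 0"]
    unfolding sum_quadratic_extend[OF assms(2,3)] .
qed

lemma psd_on_diag:
  assumes "psd_on A K" "finite A" "x \<in> A"
  shows "0 \<le> K x x"
  using psd_onD[OF psd_on_subset[OF assms(1,2)], of "{x}" "\<lambda>_. 1"] assms(3) by simp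

text \<open>With a zero at \<open>a\<close> on the diagonal, the form on \<open>{a, y}\<close> with
  weights \<open>t\<close> and 1 is affine in \<open>t\<close>. It is bounded below only if its
  slope vanishes.\<close>

lemma psd_on_zero_diag:
  assumes "psd_on A K" "finite A" "sym_on_set A K" "a \<in> A" "y \<in> A" "K a a = 0"
  shows "K a y = 0"
proof (cases "y = a")
  case False
  have "psd_on {a, y} K"
    using psd_on_subset[OF assms(1,2)] assms(4,5) by simp
  then have *: "0 \<le> 2 * t * K a y + K y y" for t
    using psd_onD[of "{a, y}" K "\<lambda>x. if x = a then t else 1"] assms(6) False
      sym_on_setD[OF assms(3,5,4)]
    by (simp add: algebra_simps)
  show ?thesis
  proof (rule ccontr)
    assume "K a y \<noteq> 0"
    \<comment> \<open>At this \<open>t\<close> the affine expression equals -1.\<close>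
    with *[of "- (K y y + 1) / (2 * K a y)"] show False by (simp add: field_simps)
  qed
qed (use assms in simp)

text \<open>Cholesky decomposition: each induction step passes to a Schur complement.\<close>

lemma psd_on_gram:
  assumes "finite A" "sym_on_set A K" "psd_on A K"
  shows "\<exists>(n :: nat) (v :: nat \<Rightarrow> 'a \<Rightarrow> real). \<forall>x\<in>A. \<forall>y\<in>A. K x y = (\<Sum>i<n. v i x * v i y)"
  using assms
proof (induction A arbitrary: K rule: finite_induct)
  case empty
  show ?case by simp
next
  case (insert a A)
  \<comment> \<open>Subtracting the product of \<open>w\<close> with itself clears the row and
    column of \<open>a\<close>. If \<open>K a a = 0\<close>, division by zero gives
    \<open>w = 0\<close>, which agrees with the row of \<open>a\<close> being zero.\<close>
  define w where "w x = K a x / sqrt (K a a)" for x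
  have nonneg: "0 \<le> K a a"
    using psd_on_diag[OF insert.prems(2)] insert.hyps by simp
  have w_a: "w a * w y = K a y" if "y \<in> insert a A" for y
  proof (cases "K a a = 0")
    case True
    then show ?thesis
      using psd_on_zero_diag[OF insert.prems(2) _ insert.prems(1)] insert.hyps that
      by (simp add: w_def)
  next
    case False
    then show ?thesis using nonneg by (simp add: w_def)
  qed
  have psd: "psd_on A (\<lambda>x y. K x y - w x * w y)"
    unfolding psd_on_def
  proof
    fix \<xi> :: "'a \<Rightarrow> real"
    let ?L = "\<Sum>y\<in>A. K a y * \<xi> y"
    have eq: "(\<Sum>x\<in>A. \<Sum>y\<in>A. (K x y - w x * w y) * \<xi> x * \<xi> y)
        = (\<Sum>x\<in>A. \<Sum>y\<in>A. K x y * \<xi> x * \<xi> y) - ?L\<^sup>2 / K a a"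
    proof -
      have "(\<Sum>x\<in>A. \<Sum>y\<in>A. w x * w y * \<xi> x * \<xi> y) = (\<Sum>x\<in>A. w x * \<xi> x)\<^sup>2"
        by (simp add: power2_eq_square sum_product mult_ac)
      also have "(\<Sum>x\<in>A. w x * \<xi> x) = ?L / sqrt (K a a)"
        by (simp add: w_def sum_divide_distrib)
      finally show ?thesis
        using nonneg by (simp add: left_diff_distrib sum_subtractf power_divide)
    qed
    \<comment> \<open>This weight at \<open>a\<close> minimises the form when
      \<open>K a a > 0\<close>. When \<open>K a a = 0\<close>, it is 0 by division by zero, and so
      is the correction term \<open>?L\<^sup>2 / K a a\<close>.\<close>
    let ?\<eta> = "\<lambda>x. if x = a then - ?L / K a a else \<xi> x"
    have cong: "(\<Sum>y\<in>A. K a y * ?\<eta> y) = ?L"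
      "(\<Sum>x\<in>A. \<Sum>y\<in>A. K x y * ?\<eta> x * ?\<eta> y) = (\<Sum>x\<in>A. \<Sum>y\<in>A. K x y * \<xi> x * \<xi> y)"
      using insert.hyps by (auto intro!: sum.cong)
    have "0 \<le> K a a * (?\<eta> a)\<^sup>2 + 2 * ?\<eta> a * ?L + (\<Sum>x\<in>A. \<Sum>y\<in>A. K x y * \<xi> x * \<xi> y)"
      using psd_onD[OF insert.prems(2), of ?\<eta>]
      unfolding quadratic_form_insert[OF insert.hyps insert.prems(1)] cong .
    also have "\<dots> = (\<Sum>x\<in>A. \<Sum>y\<in>A. K x y * \<xi> x * \<xi> y) - ?L\<^sup>2 / K a a"
      by (cases "K a a = 0") (auto simp: power2_eq_square field_simps)
    finally show "0 \<le> (\<Sum>x\<in>A. \<Sum>y\<in>A. (K x y - w x * w y) * \<xi> x * \<xi> y)"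
      unfolding eq .
  qed
  have "sym_on_set A (\<lambda>x y. K x y - w x * w y)"
    unfolding sym_on_set_def using sym_on_setD[OF insert.prems(1)] by (simp add: mult.commute)
  from insert.IH[OF this psd] obtain n :: nat and v :: "nat \<Rightarrow> 'a \<Rightarrow> real" where v: "\<forall>x\<in>A. \<forall>y\<in>A. K x y - w x * w y = (\<Sum>i<n. v i x * v i y)"
    by blast
  \<comment> \<open>The new index \<open>n\<close> carries \<open>w\<close>; the earlier vectors are
    set to 0 at \<open>a\<close>, where the Schur complement vanishes.\<close>
  define u where "u i x = (if i = n then w x else if x = a then 0 else v i x)" for i :: nat and x
  have "K x y = (\<Sum>i<Suc n. u i x * u i y)" if "x \<in> insert a A" "y \<in> insert a A" for x y
  proof -
    have "K x y - w x * w y = (\<Sum>i<n. u i x * u i y)"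
    proof (cases "x = a \<or> y = a")
      case True
      moreover have "K x y = w x * w y"
        using True w_a[OF that(1)] w_a[OF that(2)] sym_on_setD[OF insert.prems(1) that]
        by (auto simp: mult.commute)
      ultimately show ?thesis
        by (auto simp: u_def intro!: sum.neutral)
    next
      case False
      then have "K x y - w x * w y = (\<Sum>i<n. v i x * v i y)"
        using v that by blast
      also have "\<dots> = (\<Sum>i<n. u i x * u i y)"
        using False by (intro sum.cong) (auto simp: u_def)
      finally show ?thesis .
    qed
    moreover have "u n x * u n y = w x * w y" by (simp add: u_def)
    ultimately show ?thesis by simp
  qed
  then show ?case by blast
qed

lemma psd_on_scale:
  assumes "psd_on A K"
  shows "psd_on A (\<lambda>x y. u x * K x y * u y)"
  using psd_onD[OF assms, of "\<lambda>x. u x * \<xi> x" for \<xi>] by (simp add: psd_on_def mult_ac)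

text \<open>A Gram decomposition of \<open>K\<close> writes the product as a sum over
  \<open>i\<close> of copies of \<open>L\<close> scaled on both sides by \<open>v i\<close>, each of
  them positive semidefinite.\<close>

lemma schur_product:
  assumes "finite A" "sym_on_set A K" "psd_on A K" "psd_on A L"
  shows "psd_on A (\<lambda>x y. K x y * L x y)"
  unfolding psd_on_def
proof
  fix \<xi> :: "'a \<Rightarrow> real"
  obtain n :: nat and v :: "nat \<Rightarrow> 'a \<Rightarrow> real"
    where v: "\<forall>x\<in>A. \<forall>y\<in>A. K x y = (\<Sum>i<n. v i x * v i y)"
    using psd_on_gram[OF assms(1-3)] by blast
  have "(\<Sum>x\<in>A. \<Sum>y\<in>A. K x y * L x y * \<xi> x * \<xi> y)
      = (\<Sum>x\<in>A. \<Sum>y\<in>A. \<Sum>i<n. v i x * L x y * v i y * \<xi> x * \<xi> y)"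
    using v by (intro sum.cong) (auto simp: sum_distrib_left sum_distrib_right mult_ac)
  also have "\<dots> = (\<Sum>i<n. \<Sum>x\<in>A. \<Sum>y\<in>A. v i x * L x y * v i y * \<xi> x * \<xi> y)"
    by (simp add: sum.swap[of _ _ "{..<n}"])
  also have "\<dots> \<ge> 0"
    by (intro sum_nonneg psd_onD psd_on_scale assms)
  finally show "0 \<le> (\<Sum>x\<in>A. \<Sum>y\<in>A. K x y * L x y * \<xi> x * \<xi> y)" .
qed

lemma psd_on_power:
  assumes "finite A" "sym_on_set A K" "psd_on A K"
  shows "psd_on A (\<lambda>x y. K x y ^ n)"
proof (induction n)
  case 0
  have "(\<Sum>x\<in>A. \<Sum>y\<in>A. \<xi> x * \<xi> y) = (\<Sum>x\<in>A. \<xi> x)\<^sup>2" for \<xi> :: "'a \<Rightarrow> real"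
    by (simp add: power2_eq_square sum_product)
  then show ?case by (simp add: psd_on_def)
qed (simp add: schur_product assms)

text \<open>The exponential series has positive coefficients, and all entrywise powers are positive
  semidefinite by the Schur product.\<close>

lemma psd_on_exp:
  assumes "finite A" "sym_on_set A K" "psd_on A K"
  shows "psd_on A (\<lambda>x y. exp (K x y))"
  unfolding psd_on_def
proof
  fix \<xi> :: "'a \<Rightarrow> real"
  have "(\<lambda>n. \<Sum>x\<in>A. \<Sum>y\<in>A. K x y ^ n /\<^sub>R fact n * \<xi> x * \<xi> y) sums
      (\<Sum>x\<in>A. \<Sum>y\<in>A. exp (K x y) * \<xi> x * \<xi> y)"
    by (intro sums_sum sums_mult2 exp_converges)
  moreover have "0 \<le> (\<Sum>x\<in>A. \<Sum>y\<in>A. K x y ^ n /\<^sub>R fact n * \<xi> x * \<xi> y)" for n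
  proof -
    have "(\<Sum>x\<in>A. \<Sum>y\<in>A. K x y ^ n /\<^sub>R fact n * \<xi> x * \<xi> y)
        = (\<Sum>x\<in>A. \<Sum>y\<in>A. K x y ^ n * \<xi> x * \<xi> y) /\<^sub>R fact n"
      by (simp add: sum_distrib_left mult_ac)
    then show ?thesis
      using psd_onD[OF psd_on_power[OF assms]] by simp
  qed
  ultimately show "0 \<le> (\<Sum>x\<in>A. \<Sum>y\<in>A. exp (K x y) * \<xi> x * \<xi> y)"
    by (metis (no_types, lifting) sums_le sums_zero)
qed

section \<open>Conditionally negative kernels and Schoenberg's exponential theorem\<close>

definition cnd_on :: "'a set \<Rightarrow> ('a \<Rightarrow> 'a \<Rightarrow> real) \<Rightarrow> bool" where
  "cnd_on A D \<longleftrightarrow>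
    (\<forall>\<xi>. (\<Sum>x\<in>A. \<xi> x) = 0 \<longrightarrow> (\<Sum>x\<in>A. \<Sum>y\<in>A. D x y * \<xi> x * \<xi> y) \<le> 0)"

definition strict_cnd_on :: "'a set \<Rightarrow> ('a \<Rightarrow> 'a \<Rightarrow> real) \<Rightarrow> bool" where
  "strict_cnd_on A D \<longleftrightarrow> (\<forall>\<xi>. (\<Sum>x\<in>A. \<xi> x) = 0 \<and> (\<exists>x\<in>A. \<xi> x \<noteq> 0) \<longrightarrow>
    (\<Sum>x\<in>A. \<Sum>y\<in>A. D x y * \<xi> x * \<xi> y) < 0)"

lemma strict_cnd_on_imp_cnd_on:
  assumes "strict_cnd_on A D"
  shows "cnd_on A D"
  unfolding cnd_on_def
proof (intro allI impI)
  fix \<xi> :: "'a \<Rightarrow> real"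
  assume "(\<Sum>x\<in>A. \<xi> x) = 0"
  then show "(\<Sum>x\<in>A. \<Sum>y\<in>A. D x y * \<xi> x * \<xi> y) \<le> 0"
    using assms unfolding strict_cnd_on_def
    by (cases "\<exists>x\<in>A. \<xi> x \<noteq> 0") (auto intro: less_imp_le)
qed

text \<open>Centring \<open>-D\<close> at a base point \<open>b\<close> gives a positive
  semidefinite kernel \<open>K\<close>. The kernels \<open>exp K\<close> and
  \<open>exp (- s * D)\<close> differ only by a factor depending on \<open>x\<close> and the same
  factor depending on \<open>y\<close>.\<close>

theorem schoenberg_exp:
  assumes fin: "finite A" and sym: "sym_on_set A D" and cnd: "cnd_on A D" and s: "0 \<le> s"
  shows "psd_on A (\<lambda>x y. exp (- s * D x y))"
proof (cases "A = {}")
  case False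
  then obtain b where b: "b \<in> A" by blast
  define B where "B = A - {b}"
  have A: "A = insert b B" "finite B" "b \<notin> B" using b fin by (auto simp: B_def)
  define K where "K x y = s * (D x b + D b y - D x y - D b b)" for x y
  have sums: "(\<Sum>x\<in>A. f x) = f b + (\<Sum>x\<in>B. f x)" for f :: "'a \<Rightarrow> real"
    using A by simp
  have K0: "K b y = 0" "K y b = 0" for y by (simp_all add: K_def)
  have "psd_on A K"
    unfolding psd_on_def
  proof
    fix \<xi> :: "'a \<Rightarrow> real"
    let ?S = "\<Sum>x\<in>B. \<xi> x" and ?L = "\<Sum>y\<in>B. D b y * \<xi> y"
      and ?Q = "\<Sum>x\<in>B. \<Sum>y\<in>B. D x y * \<xi> x * \<xi> y"
    \<comment> \<open>\<open>K\<close> vanishes on the row and column of \<open>b\<close>, so its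
      form ignores the weight there. Choosing that weight to make the sum zero, the form of
      \<open>K\<close> becomes \<open>-s\<close> times that of \<open>D\<close>.\<close>
    let ?\<eta> = "\<lambda>x. if x = b then - ?S else \<xi> x"
    have cong: "(\<Sum>x\<in>B. ?\<eta> x) = ?S" "(\<Sum>y\<in>B. D b y * ?\<eta> y) = ?L"
      "(\<Sum>x\<in>B. \<Sum>y\<in>B. D x y * ?\<eta> x * ?\<eta> y) = ?Q"
      using A(3) by (auto intro!: sum.cong)
    have "(\<Sum>x\<in>A. ?\<eta> x) = 0"
      unfolding sums cong by simp
    then have "(\<Sum>x\<in>A. \<Sum>y\<in>A. D x y * ?\<eta> x * ?\<eta> y) \<le> 0"
      using cnd unfolding cnd_on_def by blast
    then have "D b b * (?\<eta> b)\<^sup>2 + 2 * ?\<eta> b * ?L + ?Q \<le> 0"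
      using quadratic_form_insert[OF A(2,3), of D ?\<eta>] sym
      unfolding A(1)[symmetric] cong by (simp only: )
    then have le: "0 \<le> 2 * ?S * ?L - ?Q - D b b * ?S\<^sup>2"
      by simp
    have "(\<Sum>x\<in>A. \<Sum>y\<in>A. K x y * \<xi> x * \<xi> y) = s * (2 * ?S * ?L - ?Q - D b b * ?S\<^sup>2)"
    proof -
      have "(\<Sum>x\<in>A. \<Sum>y\<in>A. K x y * \<xi> x * \<xi> y) = (\<Sum>x\<in>B. \<Sum>y\<in>B. K x y * \<xi> x * \<xi> y)"
        unfolding sums by (simp add: K0)
      also have "\<dots> = (\<Sum>x\<in>B. \<Sum>y\<in>B. s * ((D b x * \<xi> x) * \<xi> y + \<xi> x * (D b y * \<xi> y)
          - D x y * \<xi> x * \<xi> y - D b b * (\<xi> x * \<xi> y)))"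
      proof (intro sum.cong[OF refl])
        fix x y assume "x \<in> B"
        then have "D x b = D b x" using A by (intro sym_on_setD[OF sym]) auto
        then show "K x y * \<xi> x * \<xi> y = s * ((D b x * \<xi> x) * \<xi> y + \<xi> x * (D b y * \<xi> y)
          - D x y * \<xi> x * \<xi> y - D b b * (\<xi> x * \<xi> y))"
          by (simp add: K_def algebra_simps)
      qed
      also have "\<dots> = s * (?L * ?S + ?S * ?L - ?Q - D b b * (?S * ?S))"
        by (simp only: sum_distrib_left[symmetric] sum_product sum.distrib sum_subtractf)
      finally show ?thesis by (simp add: power2_eq_square algebra_simps)
    qed
    then show "0 \<le> (\<Sum>x\<in>A. \<Sum>y\<in>A. K x y * \<xi> x * \<xi> y)"
      using mult_nonneg_nonneg[OF s le] by (simp only: )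
  qed
  moreover have "sym_on_set A K"
    unfolding sym_on_set_def K_def using sym_on_setD[OF sym] b by simp
  ultimately have "psd_on A (\<lambda>x y. exp (K x y))"
    using psd_on_exp fin by blast
  \<comment> \<open>The factors cancel the terms \<open>D x b\<close> and \<open>D b y\<close> of
    \<open>K\<close>, and each takes half of the constant \<open>D b b\<close>.\<close>
  then have psd: "psd_on A (\<lambda>x y. exp (s * (D b b / 2 - D x b)) * exp (K x y) * exp (s * (D b b / 2 - D y b)))"
    by (rule psd_on_scale)
  have "exp (s * (D b b / 2 - D x b)) * exp (K x y) * exp (s * (D b b / 2 - D y b)) = exp (- s * D x y)"
    if "x \<in> A" "y \<in> A" for x y
  proof -
    have "D y b = D b y" using sym_on_setD[OF sym that(2) b] .
    then show ?thesis by (simp add: exp_add[symmetric] K_def algebra_simps)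
  qed
  then show ?thesis
    using psd by (subst (asm) psd_on_cong)
qed (simp add: psd_on_def)

subsection \<open>Powers of conditionally negative kernels\<close>

text \<open>A nonnegative function with integral zero vanishes almost everywhere, which fails on the
  unit interval after \<open>S\<close>.\<close>

lemma has_bochner_integral_pos:
  fixes f :: "real \<Rightarrow> real"
  assumes f: "has_bochner_integral lborel f I"
    and nonneg: "\<And>s. 0 \<le> f s" and pos: "\<And>s. S < s \<Longrightarrow> 0 < f s"
  shows "0 < I"
proof -
  have I: "integrable lborel f" "integral\<^sup>L lborel f = I"
    using f by (simp_all add: has_bochner_integral_iff)
  have "I \<noteq> 0"
  proof
    assume "I = 0"
    then have "AE s in lborel. f s = 0"
      using integral_nonneg_eq_0_iff_AE[OF I(1)] I(2) nonneg by simp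
    then have "AE s in lborel. s \<notin> {S<..<S+1}"
      by eventually_elim (use pos in \<open>force dest: less_imp_neq\<close>)
    then have "{S<..<S+1} \<in> null_sets lborel"
      by (subst (asm) AE_iff_null_sets[symmetric]) auto
    then show False by (simp add: null_sets_def)
  qed
  moreover have "0 \<le> I"
    using I(2) nonneg by (auto intro: integral_nonneg)
  ultimately show ?thesis by simp
qed

text \<open>Passes from gauge integrals to Lebesgue integrals: a nonnegative integrable function is
  absolutely integrable, and Borel measurability replaces \<open>lebesgue\<close> by
  \<open>lborel\<close>.\<close>

lemma integrable_lborel_indicator_powr:
  fixes S :: "real set"
  assumes "(\<lambda>x. x powr b) integrable_on S" "S \<in> sets borel"
  shows "integrable lborel (\<lambda>x. indicator S x * x powr b)"
proof -
  have "(\<lambda>x. x powr b) absolutely_integrable_on S"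
    using assms(1) by (intro nonnegative_absolutely_integrable_1) auto
  then have "integrable lebesgue (\<lambda>x. indicator S x * x powr b)"
    by (simp add: set_integrable_def)
  then show ?thesis
    using assms(2) by (subst (asm) integrable_completion) auto
qed

text \<open>\<open>C\<close> is the integral at \<open>t = 1\<close>; the substitution of
  \<open>t * s\<close> for \<open>s\<close> pulls out the factor \<open>t powr a\<close>. The bounds
  on \<open>a\<close> give convergence at infinity and at 0.\<close>

lemma powr_integral_representation:
  fixes a :: real
  assumes a: "0 < a" "a < 1"
  obtains C where "0 < C" and "\<And>t. 0 \<le> t \<Longrightarrow>
    has_bochner_integral lborel (\<lambda>s. indicator {0<..} s * (1 - exp (- s * t)) * s powr (- 1 - a))
      (C * t powr a)"
proof -
  define f where "f s = indicator {0<..} s * (1 - exp (- s)) * s powr (- 1 - a)" for s :: real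
  \<comment> \<open>Majorant from \<open>1 - exp (- s) \<le> s\<close> near 0 and
    \<open>1 - exp (- s) \<le> 1\<close> at infinity; the overlap at 1 only enlarges it.\<close>
  define g where "g s = indicator {0..1} s * s powr (- a) + indicator {1..} s * s powr (- 1 - a)"
    for s :: real
  have "integrable lborel g"
    unfolding g_def using a
      has_integral_powr_from_0[of "- a" 1] has_integral_powr_to_inf[of "- 1 - a" 1]
    by (intro Bochner_Integration.integrable_add integrable_lborel_indicator_powr) auto
  moreover have "norm (f s) \<le> norm (g s)" for s
  proof (cases "0 < s")
    case True
    have "1 - exp (- s) \<le> s" using exp_ge_add_one_self[of "- s"] by simp
    then have "(1 - exp (- s)) * s powr (- 1 - a) \<le> s * s powr (- 1 - a)"
      by (intro mult_right_mono) auto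
    also have "s * s powr (- 1 - a) = s powr (- a)"
      using True powr_add[of s 1 "- 1 - a"] by simp
    finally have "f s \<le> s powr (- a)" "0 \<le> f s" using True by (auto simp: f_def)
    moreover have "f s \<le> s powr (- 1 - a)" using True by (simp add: f_def mult_left_le_one_le)
    ultimately show ?thesis using True by (auto simp: g_def indicator_def)
  qed (simp add: f_def)
  moreover have "f \<in> borel_measurable lborel" unfolding f_def by measurable
  ultimately have int: "integrable lborel f"
    by (intro Bochner_Integration.integrable_bound[of lborel g f]) auto
  define C where "C = integral\<^sup>L lborel f"
  have f: "has_bochner_integral lborel f C"
    using int by (simp add: C_def has_bochner_integral_iff)
  show ?thesis
  proof
    show "0 < C"
      by (rule has_bochner_integral_pos[OF f, of 0]) (auto simp: f_def indicator_def)
    fix t :: real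
    assume "0 \<le> t"
    show "has_bochner_integral lborel
      (\<lambda>s. indicator {0<..} s * (1 - exp (- s * t)) * s powr (- 1 - a)) (C * t powr a)"
    proof (cases "t = 0")
      case False
      with \<open>0 \<le> t\<close> have t: "0 < t" by simp
      have "has_bochner_integral lborel (\<lambda>s. f (0 + t * s)) (C /\<^sub>R \<bar>t\<bar>)"
        using f t by (subst lborel_has_bochner_integral_real_affine_iff[symmetric]) auto
      then have "has_bochner_integral lborel (\<lambda>s. t powr (1 + a) * f (t * s)) (t powr (1 + a) * (C / t))"
        using t by (intro has_bochner_integral_mult_right) (auto simp: divide_inverse mult.commute)
      moreover have "t powr (1 + a) * (C / t) = C * t powr a"
        using t by (simp add: powr_add)
      moreover have "t powr (1 + a) * f (t * s) =
          indicator {0<..} s * (1 - exp (- s * t)) * s powr (- 1 - a)" for s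
      proof (cases "0 < s")
        case True
        have "t powr (1 + a) * t powr (- 1 - a) = 1"
          using t by (simp add: powr_add[symmetric])
        then show ?thesis
          using t True by (simp add: f_def powr_mult mult_ac)
      next
        case False
        then have "\<not> 0 < t * s" using t by (simp add: zero_less_mult_iff)
        with False show ?thesis by (simp add: f_def)
      qed
      ultimately show ?thesis by simp
    qed (simp add: has_bochner_integral_zero)
  qed
qed

text \<open>As the weights sum to zero, the 1 in \<open>1 - exp (- s * D x y)\<close> contributes
  nothing. So \<open>-C\<close> times the form is the integral of \<open>G\<close>, which is
  nonnegative by Schoenberg and positive for large \<open>s\<close>.\<close>

theorem cnd_on_powr_strict:
  assumes fin: "finite A" and sym: "sym_on_set A D" and cnd: "cnd_on A D"
    and diag: "\<And>x. x \<in> A \<Longrightarrow> D x x = 0"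
    and pos: "\<And>x y. x \<in> A \<Longrightarrow> y \<in> A \<Longrightarrow> x \<noteq> y \<Longrightarrow> 0 < D x y"
    and a: "0 < a" "a < 1"
    and \<xi>: "(\<Sum>x\<in>A. \<xi> x) = 0" "\<exists>x\<in>A. \<xi> x \<noteq> 0"
  shows "(\<Sum>x\<in>A. \<Sum>y\<in>A. D x y powr a * \<xi> x * \<xi> y) < 0"
proof -
  obtain C where C: "0 < C" "\<And>t. 0 \<le> t \<Longrightarrow> has_bochner_integral lborel
      (\<lambda>s. indicator {0<..} s * (1 - exp (- s * t)) * s powr (- 1 - a)) (C * t powr a)"
    using powr_integral_representation[OF a] by blast
  define E where "E s = (\<Sum>x\<in>A. \<Sum>y\<in>A. exp (- s * D x y) * \<xi> x * \<xi> y)" for s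
  define G where "G s = indicator {0<..} s * E s * s powr (- 1 - a)" for s
  have D: "0 \<le> D x y" if "x \<in> A" "y \<in> A" for x y
    using diag pos that by (cases "x = y") (auto intro: less_imp_le)
  have "has_bochner_integral lborel (\<lambda>s. - (\<Sum>x\<in>A. \<Sum>y\<in>A.
      indicator {0<..} s * (1 - exp (- s * D x y)) * s powr (- 1 - a) * \<xi> x * \<xi> y))
      (- (\<Sum>x\<in>A. \<Sum>y\<in>A. C * D x y powr a * \<xi> x * \<xi> y))"
    using D by (intro has_bochner_integral_minus has_bochner_integral_sum
        has_bochner_integral_mult_left C(2))
  moreover have "- (\<Sum>x\<in>A. \<Sum>y\<in>A.
      indicator {0<..} s * (1 - exp (- s * D x y)) * s powr (- 1 - a) * \<xi> x * \<xi> y) = G s" for s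
  proof -
    have "(\<Sum>x\<in>A. \<Sum>y\<in>A. (1 - exp (- s * D x y)) * \<xi> x * \<xi> y)
        = (\<Sum>x\<in>A. \<Sum>y\<in>A. \<xi> x * \<xi> y) - E s"
      by (simp add: E_def left_diff_distrib sum_subtractf)
    also have "(\<Sum>x\<in>A. \<Sum>y\<in>A. \<xi> x * \<xi> y) = 0"
      using \<xi>(1) by (simp add: sum_product[symmetric])
    finally have "E s = - (\<Sum>x\<in>A. \<Sum>y\<in>A. (1 - exp (- s * D x y)) * \<xi> x * \<xi> y)"
      by simp
    then show ?thesis
      by (simp add: G_def sum_distrib_left sum_distrib_right mult_ac)
  qed
  moreover have "(\<Sum>x\<in>A. \<Sum>y\<in>A. C * D x y powr a * \<xi> x * \<xi> y)
      = C * (\<Sum>x\<in>A. \<Sum>y\<in>A. D x y powr a * \<xi> x * \<xi> y)"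
    by (simp add: sum_distrib_left mult_ac)
  ultimately have int: "has_bochner_integral lborel G
      (- (C * (\<Sum>x\<in>A. \<Sum>y\<in>A. D x y powr a * \<xi> x * \<xi> y)))"
    by simp
  have E_nonneg: "0 \<le> E s" if "0 \<le> s" for s
    unfolding E_def by (rule psd_onD[OF schoenberg_exp[OF fin sym cnd that]])
  \<comment> \<open>Positive off-diagonal entries decay and zero diagonal entries stay 1 under the
    exponential, so the limit is the sum of squared weights.\<close>
  have lim: "(E \<longlongrightarrow> (\<Sum>x\<in>A. \<Sum>y\<in>A. (if x = y then 1 else 0) * \<xi> x * \<xi> y)) at_top"
    unfolding E_def
  proof (intro tendsto_intros)
    fix x y assume xy: "x \<in> A" "y \<in> A"
    show "((\<lambda>s. exp (- s * D x y)) \<longlongrightarrow> (if x = y then 1 else 0)) at_top"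
    proof (cases "x = y")
      case False
      have "filterlim (\<lambda>s. s * D x y) at_top at_top"
        using pos[OF xy False] by (simp add: filterlim_at_top_mult_tendsto_pos[OF tendsto_const _ filterlim_ident])
      then have "((\<lambda>s. exp (- (s * D x y))) \<longlongrightarrow> 0) at_top"
        by (intro filterlim_compose[OF exp_at_bot] filterlim_compose[OF filterlim_uminus_at_bot_at_top])
      with False show ?thesis by simp
    qed (use xy diag in simp)
  qed
  have "(\<Sum>x\<in>A. \<Sum>y\<in>A. (if x = y then 1 else 0) * \<xi> x * \<xi> y) = (\<Sum>x\<in>A. (\<xi> x)\<^sup>2)"
    using fin by (simp add: if_distrib if_distribR power2_eq_square cong: if_cong)
  also have "\<dots> > 0"
    using \<xi>(2) fin by (auto intro!: sum_pos2)
  finally obtain S where S: "\<And>s. S \<le> s \<Longrightarrow> 0 < E s"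
    using order_tendstoD(1)[OF lim] unfolding eventually_at_top_linorder by blast
  have "0 < - (C * (\<Sum>x\<in>A. \<Sum>y\<in>A. D x y powr a * \<xi> x * \<xi> y))"
    using int
  \<comment> \<open>The maximum with 0 is taken because \<open>G\<close> is cut off to positive
    \<open>s\<close>.\<close>
  proof (rule has_bochner_integral_pos[where S = "max S 0"])
    show "0 \<le> G s" for s using E_nonneg[of s] by (auto simp: G_def indicator_def)
    show "0 < G s" if "max S 0 < s" for s using S[of s] that by (auto simp: G_def)
  qed
  with C(1) show ?thesis by (simp add: mult_less_0_iff)
qed

section \<open>Strictness at exponent 1 versus negativity at a larger exponent\<close>

lemma compact_l1_sphere:
  fixes A :: "'a set"
  assumes "finite A"
  shows "compact {\<xi> :: 'a \<Rightarrow> real. (\<forall>x. x \<notin> A \<longrightarrow> \<xi> x = 0) \<and> (\<Sum>x\<in>A. \<xi> x) = 0 \<and> (\<Sum>x\<in>A. \<bar>\<xi> x\<bar>) = 1}"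
    (is "compact ?K")
proof -
  \<comment> \<open>Pinning functions to 0 outside \<open>A\<close> makes this box a product of
    compact sets over the whole type, so Tychonoff applies.\<close>
  let ?P = "PiE UNIV (\<lambda>x. if x \<in> A then {-1..1} else {0}) :: ('a \<Rightarrow> real) set"
  have "compactin (product_topology (\<lambda>_::'a. euclidean) UNIV) ?P"
    by (subst compactin_PiE) auto
  then have "compact ?P"
    by (simp add: euclidean_product_topology)
  moreover have "closed {\<xi> :: 'a \<Rightarrow> real. (\<Sum>x\<in>A. \<xi> x) = 0}"
    "closed {\<xi> :: 'a \<Rightarrow> real. (\<Sum>x\<in>A. \<bar>\<xi> x\<bar>) = 1}"
    by (intro closed_Collect_eq continuous_intros continuous_on_product_coordinates)+
  ultimately have "compact (?P \<inter> {\<xi>. (\<Sum>x\<in>A. \<xi> x) = 0} \<inter> {\<xi>. (\<Sum>x\<in>A. \<bar>\<xi> x\<bar>) = 1})"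
    by (intro compact_Int_closed)
  also have "?P \<inter> {\<xi>. (\<Sum>x\<in>A. \<xi> x) = 0} \<inter> {\<xi>. (\<Sum>x\<in>A. \<bar>\<xi> x\<bar>) = 1} = ?K"
  proof -
    have "\<xi> \<in> ?P" if "\<xi> \<in> ?K" for \<xi>
    proof -
      have "\<bar>\<xi> x\<bar> \<le> 1" if "x \<in> A" for x
        using member_le_sum[of x A "\<lambda>x. \<bar>\<xi> x\<bar>"] assms \<open>\<xi> \<in> ?K\<close> that by auto
      then show ?thesis using that by (auto simp: PiE_UNIV_domain abs_le_iff)
    qed
    moreover have "\<xi> x = 0" if "\<xi> \<in> ?P" "x \<notin> A" for \<xi> x
      using PiE_mem[OF that(1), of x] that(2) by simp
    ultimately show ?thesis by auto
  qed
  finally show ?thesis .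
qed

text \<open>On the compact sphere the form is at most some \<open>-c < 0\<close>. For
  \<open>q\<close> slightly above 1 every entry moves by less than \<open>c\<close>, hence the form
  by at most \<open>c\<close>; homogeneity covers all other weights.\<close>

lemma strict_cnd_on_imp_powr_cnd_on:
  assumes fin: "finite A" and D: "\<And>x y. x \<in> A \<Longrightarrow> y \<in> A \<Longrightarrow> 0 \<le> D x y"
    and strict: "strict_cnd_on A D"
  shows "\<exists>q>1. cnd_on A (\<lambda>x y. D x y powr q)"
proof -
  define K where "K = {\<xi> :: 'a \<Rightarrow> real. (\<forall>x. x \<notin> A \<longrightarrow> \<xi> x = 0) \<and> (\<Sum>x\<in>A. \<xi> x) = 0 \<and> (\<Sum>x\<in>A. \<bar>\<xi> x\<bar>) = 1}"
  define Q where "Q \<xi> = (\<Sum>x\<in>A. \<Sum>y\<in>A. D x y * \<xi> x * \<xi> y)" for \<xi>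
  \<comment> \<open>The sphere is empty when \<open>A\<close> has fewer than two points; then
    \<open>c = 1\<close> serves.\<close>
  obtain c where c: "0 < c" "\<And>\<xi>. \<xi> \<in> K \<Longrightarrow> Q \<xi> \<le> - c"
  proof (cases "K = {}")
    case False
    have "continuous_on K Q"
      unfolding Q_def
      by (intro continuous_intros continuous_on_subset[OF continuous_on_product_coordinates]) auto
    then obtain \<xi> where \<xi>: "\<xi> \<in> K" "\<And>\<eta>. \<eta> \<in> K \<Longrightarrow> Q \<eta> \<le> Q \<xi>"
      using continuous_attains_sup[OF _ False] compact_l1_sphere[OF fin]
      unfolding K_def[symmetric] by blast
    have "\<exists>x\<in>A. \<xi> x \<noteq> 0"
    proof (rule ccontr)
      assume "\<not> ?thesis"
      with \<xi>(1) show False by (simp add: K_def)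
    qed
    with \<xi>(1) have "Q \<xi> < 0"
      using strict by (simp add: K_def Q_def strict_cnd_on_def)
    with \<xi>(2) show ?thesis by (intro that[of "- Q \<xi>"]) auto
  qed (use that[of 1] in auto)
  have "((\<lambda>q. D x y powr q) \<longlongrightarrow> D x y) (at_right 1)" if "x \<in> A" "y \<in> A" for x y
  \<comment> \<open>Continuity in the exponent is invoked for nonzero bases; \<open>0 powr q\<close>
    is constantly 0.\<close>
  proof (cases "D x y = 0")
    case False
    then have "((\<lambda>q. D x y powr q) \<longlongrightarrow> D x y powr 1) (at_right 1)"
      by (intro tendsto_intros) auto
    then show ?thesis using D[OF that] by simp
  qed simp
  then have "\<forall>\<^sub>F q in at_right 1. \<forall>x\<in>A. \<forall>y\<in>A. dist (D x y powr q) (D x y) < c"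
    using fin c(1) by (intro eventually_ball_finite ballI tendstoD) auto
  moreover have "\<forall>\<^sub>F q :: real in at_right 1. 1 < q"
    by (rule eventually_at_right_less)
  ultimately have "\<forall>\<^sub>F q in at_right 1. 1 < q \<and> (\<forall>x\<in>A. \<forall>y\<in>A. dist (D x y powr q) (D x y) < c)"
    by eventually_elim auto
  from eventually_happens'[OF trivial_limit_at_right_real this]
  obtain q where q: "1 < q" "\<And>x y. x \<in> A \<Longrightarrow> y \<in> A \<Longrightarrow> \<bar>D x y powr q - D x y\<bar> < c"
    by (auto simp: dist_real_def)
  have "cnd_on A (\<lambda>x y. D x y powr q)"
    unfolding cnd_on_def
  proof (intro allI impI)
    fix \<xi> :: "'a \<Rightarrow> real"
    assume \<xi>: "(\<Sum>x\<in>A. \<xi> x) = 0"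
    define N where "N = (\<Sum>x\<in>A. \<bar>\<xi> x\<bar>)"
    show "(\<Sum>x\<in>A. \<Sum>y\<in>A. D x y powr q * \<xi> x * \<xi> y) \<le> 0"
    proof (cases "N = 0")
      case True
      then have "\<And>x. x \<in> A \<Longrightarrow> \<xi> x = 0"
        using fin by (simp add: N_def sum_nonneg_eq_0_iff)
      then show ?thesis by simp
    next
      case False
      then have N: "0 < N" by (simp add: N_def order_less_le sum_nonneg)
      define \<eta> where "\<eta> x = (if x \<in> A then \<xi> x / N else 0)" for x
      have \<xi>_\<eta>: "\<xi> x = N * \<eta> x" if "x \<in> A" for x
        using N that by (simp add: \<eta>_def)
      have abs_\<eta>: "(\<Sum>x\<in>A. \<bar>\<eta> x\<bar>) = 1"
        using N by (simp add: \<eta>_def N_def[symmetric] sum_divide_distrib[symmetric])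
      have "(\<Sum>x\<in>A. \<eta> x) = 0"
        using \<xi> by (simp add: \<eta>_def sum_divide_distrib[symmetric])
      with abs_\<eta> have "\<eta> \<in> K" by (simp add: K_def \<eta>_def)
      have "(\<Sum>x\<in>A. \<Sum>y\<in>A. D x y powr q * \<eta> x * \<eta> y) - Q \<eta>
          = (\<Sum>x\<in>A. \<Sum>y\<in>A. (D x y powr q - D x y) * \<eta> x * \<eta> y)"
        by (simp add: Q_def left_diff_distrib sum_subtractf)
      \<comment> \<open>The products of the absolute weights sum to 1 on the sphere, so this bound
        totals exactly \<open>c\<close>.\<close>
      also have "\<dots> \<le> (\<Sum>x\<in>A. \<Sum>y\<in>A. c * \<bar>\<eta> x\<bar> * \<bar>\<eta> y\<bar>)"
      proof (intro sum_mono)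
        fix x y assume "x \<in> A" "y \<in> A"
        have "(D x y powr q - D x y) * \<eta> x * \<eta> y \<le> \<bar>D x y powr q - D x y\<bar> * (\<bar>\<eta> x\<bar> * \<bar>\<eta> y\<bar>)"
          by (metis abs_ge_self abs_mult mult.assoc)
        also have "\<dots> \<le> c * (\<bar>\<eta> x\<bar> * \<bar>\<eta> y\<bar>)"
          using q(2)[OF \<open>x \<in> A\<close> \<open>y \<in> A\<close>] by (intro mult_right_mono) auto
        finally show "(D x y powr q - D x y) * \<eta> x * \<eta> y \<le> c * \<bar>\<eta> x\<bar> * \<bar>\<eta> y\<bar>"
          by (simp only: mult.assoc)
      qed
      also have "\<dots> = c * ((\<Sum>x\<in>A. \<bar>\<eta> x\<bar>) * (\<Sum>x\<in>A. \<bar>\<eta> x\<bar>))"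
        by (simp only: sum_product) (simp add: sum_distrib_left mult.assoc)
      finally have "(\<Sum>x\<in>A. \<Sum>y\<in>A. D x y powr q * \<eta> x * \<eta> y) \<le> 0"
        using c(2)[OF \<open>\<eta> \<in> K\<close>] abs_\<eta> by simp
      moreover have "(\<Sum>x\<in>A. \<Sum>y\<in>A. D x y powr q * \<xi> x * \<xi> y)
          = N\<^sup>2 * (\<Sum>x\<in>A. \<Sum>y\<in>A. D x y powr q * \<eta> x * \<eta> y)"
        by (simp add: \<xi>_\<eta> sum_distrib_left power2_eq_square mult_ac)
      ultimately show ?thesis by (simp add: mult_nonneg_nonpos)
    qed
  qed
  with q(1) show ?thesis by blast
qed

text \<open>The exponent \<open>1 / q\<close> lies strictly between 0 and 1 and turns
  \<open>D x y powr q\<close> back into \<open>D x y\<close>.\<close>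

lemma powr_cnd_on_imp_strict_cnd_on:
  assumes "finite A" "sym_on_set A D"
    and diag: "\<And>x. x \<in> A \<Longrightarrow> D x x = 0"
    and pos: "\<And>x y. x \<in> A \<Longrightarrow> y \<in> A \<Longrightarrow> x \<noteq> y \<Longrightarrow> 0 < D x y"
    and "1 < q" "cnd_on A (\<lambda>x y. D x y powr q)"
  shows "strict_cnd_on A D"
  unfolding strict_cnd_on_def
proof (intro allI impI, elim conjE)
  fix \<xi> :: "'a \<Rightarrow> real"
  assume "(\<Sum>x\<in>A. \<xi> x) = 0" "\<exists>x\<in>A. \<xi> x \<noteq> 0"
  moreover have "sym_on_set A (\<lambda>x y. D x y powr q)"
    unfolding sym_on_set_def using sym_on_setD[OF assms(2)] by simp
  ultimately have "(\<Sum>x\<in>A. \<Sum>y\<in>A. (D x y powr q) powr (1 / q) * \<xi> x * \<xi> y) < 0"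
    using assms(1,5,6) diag pos by (intro cnd_on_powr_strict) (auto simp: less_imp_neq[THEN not_sym])
  moreover have "(D x y powr q) powr (1 / q) = D x y" if "x \<in> A" "y \<in> A" for x y
    using that diag pos[of x y] assms(5) by (cases "x = y") (auto simp: powr_powr)
  ultimately show "(\<Sum>x\<in>A. \<Sum>y\<in>A. D x y * \<xi> x * \<xi> y) < 0" by simp
qed

section \<open>From kernels on a finite set to negative type\<close>

lemma sum_extend:
  fixes \<xi> :: "'a \<Rightarrow> real"
  assumes "finite B" "A \<subseteq> B"
  shows "(\<Sum>x\<in>B. if x \<in> A then \<xi> x else 0) = (\<Sum>x\<in>A. \<xi> x)"
  using assms by (simp add: sum.inter_restrict[symmetric] Int_absorb1)

text \<open>Weights on a subset extend by zero to all of \<open>X\<close>, so the one form on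
  \<open>X\<close> governs every finite subset.\<close>

lemma negative_type_iff_cnd_on:
  assumes "finite X"
  shows "negative_type X \<rho> q \<longleftrightarrow> cnd_on X (\<lambda>x y. \<rho> x y powr q)"
proof
  assume cnd: "cnd_on X (\<lambda>x y. \<rho> x y powr q)"
  show "negative_type X \<rho> q"
    unfolding negative_type_def
  proof (intro allI impI, elim conjE)
    fix F and \<xi> :: "'a \<Rightarrow> real"
    assume F: "F \<subseteq> X" and "(\<Sum>y\<in>F. \<xi> y) = 0"
    then show "(\<Sum>y\<in>F. \<Sum>z\<in>F. \<rho> y z powr q * \<xi> y * \<xi> z) \<le> 0"
      using cnd[unfolded cnd_on_def, rule_format, of "\<lambda>x. if x \<in> F then \<xi> x else 0"]
      unfolding sum_quadratic_extend[OF assms F] sum_extend[OF assms F] by blast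
  qed
qed (use assms in \<open>auto simp: negative_type_def cnd_on_def\<close>)

lemma strict_negative_type_iff_strict_cnd_on:
  assumes "finite X"
  shows "strict_negative_type X \<rho> q \<longleftrightarrow> strict_cnd_on X (\<lambda>x y. \<rho> x y powr q)"
proof
  assume strict: "strict_cnd_on X (\<lambda>x y. \<rho> x y powr q)"
  show "strict_negative_type X \<rho> q"
    unfolding strict_negative_type_def
  proof (intro conjI allI impI; (elim conjE)?)
    show "negative_type X \<rho> q"
      using strict_cnd_on_imp_cnd_on[OF strict] negative_type_iff_cnd_on[OF assms] by blast
    fix F and \<xi> :: "'a \<Rightarrow> real"
    assume F: "F \<subseteq> X" and "(\<Sum>y\<in>F. \<xi> y) = 0" "\<exists>y\<in>F. \<xi> y \<noteq> 0"
    moreover from this have "\<exists>x\<in>X. (if x \<in> F then \<xi> x else 0) \<noteq> 0" by auto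
    ultimately show "(\<Sum>y\<in>F. \<Sum>z\<in>F. \<rho> y z powr q * \<xi> y * \<xi> z) < 0"
      using strict[unfolded strict_cnd_on_def, rule_format, of "\<lambda>x. if x \<in> F then \<xi> x else 0"]
      unfolding sum_quadratic_extend[OF assms F] sum_extend[OF assms F] by blast
  qed
qed (use assms in \<open>auto simp: strict_negative_type_def strict_cnd_on_def\<close>)

lemma less_supremal_negative_type_iff:
  assumes "0 \<le> p"
  shows "ennreal p < supremal_negative_type Y \<rho> \<longleftrightarrow> (\<exists>q>p. negative_type Y \<rho> q)"
  using assms by (auto simp: supremal_negative_type_def less_SUP_iff ennreal_less_iff
      intro: order.trans less_imp_le)

subsection \<open>Subsets of the cube\<close>

definition cube :: "(real ^ 'n) set" where
  "cube = {x. \<forall>k. x $ k \<in> {0, 1}}"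

lemma lp_dist_1: "lp_dist 1 x y = (\<Sum>k\<in>UNIV. \<bar>x $ k - y $ k\<bar>)"
  by (simp add: lp_dist_def sum_nonneg)

text \<open>Coordinate differences are 0 or 1 in absolute value and thus fixed by
  \<open>powr p\<close>.\<close>

lemma lp_dist_powr_cube:
  fixes x y :: "real ^ 'n"
  assumes "x \<in> cube" "y \<in> cube"
  shows "lp_dist p x y powr q = lp_dist 1 x y powr (q / p)"
proof -
  have "\<bar>x $ k - y $ k\<bar> powr p = \<bar>x $ k - y $ k\<bar>" for k
  proof -
    have "x $ k \<in> {0, 1}" "y $ k \<in> {0, 1}" using assms unfolding cube_def by blast+
    then show ?thesis by auto
  qed
  then show ?thesis unfolding lp_dist_1 by (simp add: lp_dist_def powr_powr)
qed

lemma lp_dist_1_cube: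
  fixes x y :: "real ^ 'n"
  assumes "x \<in> cube" "y \<in> cube"
  shows "lp_dist 1 x y = (\<Sum>k\<in>UNIV. x $ k) + (\<Sum>k\<in>UNIV. y $ k) - 2 * (x \<bullet> y)"
proof -
  have "\<bar>x $ k - y $ k\<bar> = x $ k + y $ k - 2 * (x $ k * y $ k)" for k
  proof -
    have "x $ k \<in> {0, 1}" "y $ k \<in> {0, 1}" using assms unfolding cube_def by blast+
    then show ?thesis by auto
  qed
  then show ?thesis
    by (simp add: lp_dist_1 inner_vec_def sum.distrib sum_subtractf sum_distrib_left)
qed

text \<open>The terms of the Hamming distance that depend on one point alone vanish because the
  weights sum to zero; the inner products remain.\<close>

lemma quadratic_form_cube:
  fixes X :: "(real ^ 'n) set"
  assumes "X \<subseteq> cube" and \<xi>: "(\<Sum>x\<in>X. \<xi> x) = 0"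
  shows "(\<Sum>x\<in>X. \<Sum>y\<in>X. lp_dist 1 x y * \<xi> x * \<xi> y) = - 2 * (norm (\<Sum>x\<in>X. \<xi> x *\<^sub>R x))\<^sup>2"
proof -
  let ?u = "\<lambda>x :: real ^ 'n. \<Sum>k\<in>UNIV. x $ k"
  have "(\<Sum>x\<in>X. \<Sum>y\<in>X. lp_dist 1 x y * \<xi> x * \<xi> y)
      = (\<Sum>x\<in>X. \<Sum>y\<in>X. ?u x * \<xi> x * \<xi> y + \<xi> x * (?u y * \<xi> y) - 2 * (\<xi> x * (\<xi> y * (x \<bullet> y))))"
  proof (intro sum.cong[OF refl])
    fix x y assume "x \<in> X" "y \<in> X"
    with assms(1) have "x \<in> cube" "y \<in> cube" by auto
    then show "lp_dist 1 x y * \<xi> x * \<xi> y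
        = ?u x * \<xi> x * \<xi> y + \<xi> x * (?u y * \<xi> y) - 2 * (\<xi> x * (\<xi> y * (x \<bullet> y)))"
      by (simp only: lp_dist_1_cube) (simp add: algebra_simps)
  qed
  also have "\<dots> = (\<Sum>x\<in>X. ?u x * \<xi> x) * (\<Sum>x\<in>X. \<xi> x) + (\<Sum>x\<in>X. \<xi> x) * (\<Sum>x\<in>X. ?u x * \<xi> x)
      - 2 * (\<Sum>x\<in>X. \<Sum>y\<in>X. \<xi> x * (\<xi> y * (x \<bullet> y)))"
    by (simp only: sum_product sum.distrib sum_subtractf sum_distrib_left[symmetric])
  also have "\<dots> = - 2 * (\<Sum>x\<in>X. \<Sum>y\<in>X. \<xi> x * (\<xi> y * (x \<bullet> y)))"
    using \<xi> by simp
  also have "(\<Sum>x\<in>X. \<Sum>y\<in>X. \<xi> x * (\<xi> y * (x \<bullet> y))) = (norm (\<Sum>x\<in>X. \<xi> x *\<^sub>R x))\<^sup>2"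
    unfolding power2_norm_eq_inner inner_sum_left inner_sum_right
    by (subst sum.swap) (simp add: mult_ac inner_commute)
  finally show ?thesis .
qed

text \<open>Nonzero weights of sum zero at which the form vanishes are exactly the affine
  dependences of \<open>X\<close>.\<close>

lemma strict_cnd_on_cube_iff:
  fixes X :: "(real ^ 'n) set"
  assumes "finite X" "X \<subseteq> cube"
  shows "strict_cnd_on X (lp_dist 1) \<longleftrightarrow> \<not> affine_dependent X"
proof -
  have "(\<Sum>x\<in>X. \<Sum>y\<in>X. lp_dist 1 x y * \<xi> x * \<xi> y) < 0 \<longleftrightarrow> (\<Sum>x\<in>X. \<xi> x *\<^sub>R x) \<noteq> 0"
    if "(\<Sum>x\<in>X. \<xi> x) = 0" for \<xi>
    using quadratic_form_cube[OF assms(2) that] by simp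
  then show ?thesis
    unfolding strict_cnd_on_def affine_dependent_explicit_finite[OF assms(1)] by blast
qed

lemma cnd_on_cube:
  fixes X :: "(real ^ 'n) set"
  assumes "X \<subseteq> cube"
  shows "cnd_on X (lp_dist 1)"
  using quadratic_form_cube[OF assms] by (simp add: cnd_on_def)

lemma lp_dist_1_nonneg: "0 \<le> lp_dist 1 x y"
  by (simp add: lp_dist_1 sum_nonneg)

lemma lp_dist_1_refl: "lp_dist 1 x x = 0"
  by (simp add: lp_dist_1)

lemma lp_dist_1_pos:
  fixes x y :: "real ^ 'n"
  assumes "x \<noteq> y"
  shows "0 < lp_dist 1 x y"
proof -
  obtain k where "x $ k \<noteq> y $ k" using assms by (auto simp: vec_eq_iff)
  then show ?thesis unfolding lp_dist_1 by (intro sum_pos2[of _ k]) auto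
qed

lemma negative_type_lp_dist_cube_iff:
  fixes X :: "(real ^ 'n) set"
  assumes "finite X" "X \<subseteq> cube"
  shows "negative_type X (lp_dist p) q \<longleftrightarrow> cnd_on X (\<lambda>x y. lp_dist 1 x y powr (q / p))"
proof -
  have "lp_dist p x y powr q = lp_dist 1 x y powr (q / p)" if "x \<in> X" "y \<in> X" for x y
    using that assms(2) by (intro lp_dist_powr_cube) auto
  then show ?thesis
    by (simp add: negative_type_iff_cnd_on[OF assms(1)] cnd_on_def)
qed

text \<open>Rescaling \<open>q = r * p\<close> yields a condition free of \<open>p\<close>, which is
  why one \<open>p\<close> is as good as all.\<close>

lemma less_supremal_negative_type_cube_iff:
  fixes X :: "(real ^ 'n) set"
  assumes X: "finite X" "X \<subseteq> cube" and p: "1 \<le> p"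
  shows "ennreal p < supremal_negative_type X (lp_dist p) \<longleftrightarrow> strict_cnd_on X (lp_dist 1)"
proof -
  have "ennreal p < supremal_negative_type X (lp_dist p)
      \<longleftrightarrow> (\<exists>q>p. cnd_on X (\<lambda>x y. lp_dist 1 x y powr (q / p)))"
    using p by (simp add: less_supremal_negative_type_iff negative_type_lp_dist_cube_iff[OF X])
  also have "\<dots> \<longleftrightarrow> (\<exists>r>1. cnd_on X (\<lambda>x y. lp_dist 1 x y powr r))"
  proof
    assume "\<exists>r>1. cnd_on X (\<lambda>x y. lp_dist 1 x y powr r)"
    then obtain r where "1 < r" "cnd_on X (\<lambda>x y. lp_dist 1 x y powr r)" by blast
    with p show "\<exists>q>p. cnd_on X (\<lambda>x y. lp_dist 1 x y powr (q / p))"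
      by (intro exI[of _ "r * p"]) auto
  next
    assume "\<exists>q>p. cnd_on X (\<lambda>x y. lp_dist 1 x y powr (q / p))"
    then obtain q where "p < q" "cnd_on X (\<lambda>x y. lp_dist 1 x y powr (q / p))" by blast
    with p show "\<exists>r>1. cnd_on X (\<lambda>x y. lp_dist 1 x y powr r)"
      by (intro exI[of _ "q / p"]) auto
  qed
  also have "\<dots> \<longleftrightarrow> strict_cnd_on X (lp_dist 1)"
  proof
    assume "\<exists>r>1. cnd_on X (\<lambda>x y. lp_dist 1 x y powr r)"
    moreover have "sym_on_set X (lp_dist 1)"
      unfolding sym_on_set_def lp_dist_1 by (simp add: abs_minus_commute)
    ultimately show "strict_cnd_on X (lp_dist 1)"
      using powr_cnd_on_imp_strict_cnd_on[OF X(1)] lp_dist_1_pos lp_dist_1_refl by blast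
  next
    assume "strict_cnd_on X (lp_dist 1)"
    then show "\<exists>r>1. cnd_on X (\<lambda>x y. lp_dist 1 x y powr r)"
      using X(1) by (intro strict_cnd_on_imp_powr_cnd_on) (auto simp: lp_dist_1_nonneg)
  qed
  finally show ?thesis .
qed

theorem theorem3p5:
  fixes X :: "(real ^ 'n) set" and m :: nat
  assumes "CARD('n) \<ge> 2" and "m \<ge> 1"
    and "finite X" and "card X = m + 1"
    and "X \<subseteq> {x. \<forall>k. x $ k \<in> {0, 1}}"
  shows "(\<forall>p::real. p \<ge> 1 \<longrightarrow> supremal_negative_type X (lp_dist p) \<ge> ennreal p) \<and>
    (\<not> affine_dependent X \<longleftrightarrow> strict_negative_type X (lp_dist 1) 1) \<and>
    (strict_negative_type X (lp_dist 1) 1 \<longleftrightarrow>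
      (\<exists>p::real. p \<ge> 1 \<and> supremal_negative_type X (lp_dist p) > ennreal p)) \<and>
    ((\<exists>p::real. p \<ge> 1 \<and> supremal_negative_type X (lp_dist p) > ennreal p) \<longleftrightarrow>
      (\<forall>p::real. p \<ge> 1 \<longrightarrow> supremal_negative_type X (lp_dist p) > ennreal p))"
proof -
  have X: "finite X" "X \<subseteq> cube" using assms(3,5) by (simp_all add: cube_def)
  have "ennreal p \<le> supremal_negative_type X (lp_dist p)" if "1 \<le> p" for p
  proof -
    \<comment> \<open>At exponent \<open>p\<close> the kernel is \<open>lp_dist 1\<close> to the
      power \<open>p / p = 1\<close>.\<close>
    have "negative_type X (lp_dist p) p"
      using that cnd_on_cube[OF X(2)] by (simp add: negative_type_lp_dist_cube_iff[OF X] lp_dist_1_nonneg)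
    then show ?thesis
      unfolding supremal_negative_type_def using that by (intro SUP_upper) auto
  qed
  moreover have "strict_negative_type X (lp_dist 1) 1 \<longleftrightarrow> strict_cnd_on X (lp_dist 1)"
    by (simp add: strict_negative_type_iff_strict_cnd_on[OF X(1)] lp_dist_1_nonneg)
  \<comment> \<open>Without such a \<open>p\<close>, the condition for all \<open>p\<close> would
    not give the condition for some \<open>p\<close>.\<close>
  moreover have "\<exists>p::real. 1 \<le> p" by blast
  ultimately show ?thesis
    using less_supremal_negative_type_cube_iff[OF X] strict_cnd_on_cube_iff[OF X] by blast
qed

end
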